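(* Let $T$ be a $\mathbb{Z}$-weighted lattice tile. Then $T$ $\mathbb{Z}$-shapetiles a square if and only if the following two conditions hold: (1) The weighted area of $T$ is not zero. (2) For every $\mu\in\mathbb{Q}^{\times}=\mathbb{Q}\setminus\{0\}$, the gcd of the weighted areas of the $\mu$-slope classes of $T$ is $1$.
   Context: A rectangle is a product $[b_1,b_2)\times[c_1,c_2)\subset\mathbb{R}^2$ of half-open intervals with $b_1<b_2$ and $c_1<c_2$; a square is a rectangle with $b_2-b_1=c_2-c_1$. A $\mathbb{Z}$-weighted tile is represented by a finite $\mathbb{Z}$-linear combination $a_1R_1+\cdots+a_nR_n$ of disjoint rectangles; to it is associated the function $\mathbb{R}^2\to\mathbb{Z}$ with value $a_i$ on $R_i$ and $0$ outside $\bigcup R_i$, and two combinations represent the same tile if and only if the associated functions are equal. Tiles are added and multiplied by integers pointwise (as functions). An (unweighted) square is regarded as a tile with weight $1$. The weighted area of $a_1R_1+\cdots+a_nR_n$ is $\sum_i a_i\,\mathrm{area}(R_i)$. For $(i,j)\in\mathbb{Z}^2$ let $S_{ij}=[i,i+1)\times[j,j+1)$ be the unit lattice square with lower left corner $(i,j)$. A $\mathbb{Z}$-weighted lattice tile is a finite combination $T=\sum_{i,j}w_{ij}S_{ij}$ with $w_{ij}\in\mathbb{Z}$. A set $\{T_\lambda:\lambda\in\Lambda\}$ of $\mathbb{Z}$-weighted tiles $\mathbb{Z}$-tiles a $\mathbb{Z}$-weighted tile $U$ if there are finitely many weights $a_1,\dots,a_n\in\mathbb{Z}$ and tiles $\tilde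 T_1,\dots,\tilde T_n$, each a translation (by a vector in $\mathbb{R}^2$) of some $T_{\lambda_i}$, such that $a_1\tilde T_1+\cdots+a_n\tilde T_n=U$. For real $\rho>0$, $T(\rho)$ is the image of $T$ under $(x,y)\mapsto(\rho x,\rho y)$. The tile $T$ $\mathbb{Z}$-shapetiles $U$ if $\{T(\rho):\rho\in\mathbb{R},\ \rho>0\}$ $\mathbb{Z}$-tiles $U$. For $\mu\in\mathbb{Q}^\times$, two lattice squares $S_{ij}$ and $S_{i'j'}$ belong to the same $\mu$-slope class if they are equal or the line joining their centers has slope $\mu$. This is an equivalence relation on lattice squares, and it decomposes $T=\sum w_{ij}S_{ij}$ as a sum $T=C_1+\cdots+C_k$ of lattice tiles, one for each equivalence class meeting the support of $T$, where each $C_t$ is the sum of the terms $w_{ij}S_{ij}$ with $S_{ij}$ in the given class. The $C_t$ are the $\mu$-slope classes of $T$; the weighted area of $C_t$ is the sum of the corresponding weights $w_{ij}$. *)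

theory Defs
  imports "HOL-Analysis.Analysis"
begin

text \<open>A tile is identified with its associated function \<open>real \<times> real \<Rightarrow> int\<close>, so equality of
  tiles is equality of functions, and addition and integer multiples are pointwise.\<close>

type_synonym tile = "real \<times> real \<Rightarrow> int"

definition is_rectangle :: "(real \<times> real) set \<Rightarrow> bool" where
  "is_rectangle R \<longleftrightarrow> (\<exists>b1 b2 c1 c2. b1 < b2 \<and> c1 < c2 \<and> R = {b1..<b2} \<times> {c1..<c2})"

definition is_square :: "(real \<times> real) set \<Rightarrow> bool" where
  "is_square R \<longleftrightarrow>
     (\<exists>b1 b2 c1 c2. b1 < b2 \<and> c1 < c2 \<and> b2 - b1 = c2 - c1 \<and> R = {b1..<b2} \<times> {c1..<c2})"

definition represents :: "nat \<Rightarrow> (nat \<Rightarrow> int) \<Rightarrow> (nat \<Rightarrow> (real \<times> real) set) \<Rightarrow> tile \<Rightarrow> bool" where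
  "represents n a R f \<longleftrightarrow>
     (\<forall>i<n. is_rectangle (R i)) \<and> disjoint_family_on R {..<n} \<and>
     f = (\<lambda>p. \<Sum>i<n. a i * indicator (R i) p)"

definition weighted_tile :: "tile \<Rightarrow> bool" where
  "weighted_tile f \<longleftrightarrow> (\<exists>n a R. represents n a R f)"

text \<open>The value does not depend on the representation; see \<open>weighted_area_eq\<close> below.\<close>

definition weighted_area :: "tile \<Rightarrow> real" where
  "weighted_area f =
     (THE A. \<exists>n a R. represents n a R f \<and> A = (\<Sum>i<n. of_int (a i) * measure lborel (R i)))"

definition translate :: "real \<times> real \<Rightarrow> tile \<Rightarrow> tile" where
  "translate v f = (\<lambda>p. f (p - v))"

definition dilate :: "real \<Rightarrow> tile \<Rightarrow> tile" where
  "dilate \<rho> f = (\<lambda>(x, y). f (x / \<rho>, y / \<rho>))"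

definition Z_tiles :: "tile set \<Rightarrow> tile \<Rightarrow> bool" where
  "Z_tiles \<T> U \<longleftrightarrow>
     (\<exists>(n::nat) (a :: nat \<Rightarrow> int) (\<tau> :: nat \<Rightarrow> tile).
        (\<forall>i<n. \<exists>T\<in>\<T>. \<exists>v. \<tau> i = translate v T) \<and> (\<lambda>p. \<Sum>i<n. a i * \<tau> i p) = U)"

definition Z_shapetiles :: "tile \<Rightarrow> tile \<Rightarrow> bool" where
  "Z_shapetiles T U \<longleftrightarrow> Z_tiles {dilate \<rho> T |\<rho>. \<rho> > 0} U"

definition unit_square :: "int \<times> int \<Rightarrow> (real \<times> real) set" where
  "unit_square = (\<lambda>(i, j). {of_int i..<of_int i + 1} \<times> {of_int j..<of_int j + 1})"

text \<open>Lattice tiles are given by their finitely supported weight functions.\<close>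

definition lattice_tile :: "(int \<times> int \<Rightarrow> int) \<Rightarrow> tile" where
  "lattice_tile w = (\<lambda>p. \<Sum>s | w s \<noteq> 0. w s * indicator (unit_square s) p)"

definition lattice_area :: "(int \<times> int \<Rightarrow> int) \<Rightarrow> int" where
  "lattice_area w = (\<Sum>s | w s \<noteq> 0. w s)"

definition center :: "int \<times> int \<Rightarrow> real \<times> real" where
  "center = (\<lambda>(i, j). (of_int i + 1/2, of_int j + 1/2))"

definition line_slope :: "real \<times> real \<Rightarrow> real \<times> real \<Rightarrow> real \<Rightarrow> bool" where
  "line_slope p q \<mu> \<longleftrightarrow> fst p \<noteq> fst q \<and> (snd q - snd p) / (fst q - fst p) = \<mu>"

definition slope_rel :: "real \<Rightarrow> ((int \<times> int) \<times> (int \<times> int)) set" where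
  "slope_rel \<mu> = {(s, t). s = t \<or> line_slope (center s) (center t) \<mu>}"

text \<open>Each slope class is again given by its weight function. Distinct equivalence classes meeting
  the support yield distinct weight functions, so nothing is lost by forming a set.\<close>

definition slope_classes :: "real \<Rightarrow> (int \<times> int \<Rightarrow> int) \<Rightarrow> (int \<times> int \<Rightarrow> int) set" where
  "slope_classes \<mu> w =
     {(\<lambda>s. if s \<in> c then w s else 0) |c. c \<in> UNIV // slope_rel \<mu> \<and> (\<exists>s\<in>c. w s \<noteq> 0)}"

lemma equiv_slope_rel: "equiv UNIV (slope_rel \<mu>)"
proof (rule equivI)
  show "slope_rel \<mu> \<subseteq> UNIV \<times> UNIV" by simp
  show "refl_on UNIV (slope_rel \<mu>)" by (auto simp: refl_on_def slope_rel_def)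
  show "sym (slope_rel \<mu>)"
    by (auto simp: sym_def slope_rel_def line_slope_def center_def field_simps)
  have eq: "(s, t) \<in> slope_rel \<mu> \<longleftrightarrow>
      s = t \<or> (fst s \<noteq> fst t \<and> of_int (snd t) - of_int (snd s) = \<mu> * (of_int (fst t) - of_int (fst s)))" for s t
    by (cases s; cases t) (auto simp: slope_rel_def line_slope_def center_def divide_eq_eq)
  show "trans (slope_rel \<mu>)"
  proof (rule transI)
    fix s t u assume 1: "(s, t) \<in> slope_rel \<mu>" and 2: "(t, u) \<in> slope_rel \<mu>"
    have "of_int (snd t) - of_int (snd s) = \<mu> * (of_int (fst t) - of_int (fst s))"
      and "of_int (snd u) - of_int (snd t) = \<mu> * (of_int (fst u) - of_int (fst t))"
      using 1 2 by (auto simp: eq)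
    then have *: "of_int (snd u) - of_int (snd s) = \<mu> * (of_int (fst u) - of_int (fst s))"
      by (simp add: algebra_simps)
    then show "(s, u) \<in> slope_rel \<mu>"
      by (cases "fst s = fst u") (auto simp: eq prod_eq_iff)
  qed
qed

lemma rectangle_bounded_borel:
  assumes "is_rectangle R"
  shows "R \<in> sets lborel" "emeasure lborel R < \<infinity>"
proof -
  obtain b1 b2 c1 c2 :: real where R: "R = {b1..<b2} \<times> {c1..<c2}"
    using assms by (auto simp: is_rectangle_def)
  have "R \<in> sets (borel \<Otimes>\<^sub>M borel)" unfolding R by (intro pair_measureI) auto
  then show "R \<in> sets lborel" using borel_prod sets_lborel by metis
  have "R \<subseteq> cbox (b1, c1) (b2, c2)" by (auto simp: R)
  then have "bounded R" using bounded_cbox bounded_subset by blast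
  then show "emeasure lborel R < \<infinity>" by (rule emeasure_bounded_finite)
qed

lemma represents_area:
  assumes "represents n a R f"
  shows "(\<Sum>i<n. of_int (a i) * measure lborel (R i)) = (LINT p|lborel. real_of_int (f p))"
proof -
  have f: "real_of_int (f p) = (\<Sum>i<n. of_int (a i) * indicator (R i) p)" for p
    using assms by (simp add: represents_def indicator_def of_int_sum if_distrib cong: if_cong)
  have r: "R i \<in> sets lborel" "emeasure lborel (R i) < \<infinity>" if "i < n" for i
    using assms that rectangle_bounded_borel by (auto simp: represents_def)
  have "(LINT p|lborel. real_of_int (f p)) =
        (\<Sum>i<n. LINT p|lborel. of_int (a i) * indicator (R i) p)"
    unfolding f by (intro Bochner_Integration.integral_sum integrable_mult_right integrable_real_indicator) (use r in auto)
  also have "\<dots> = (\<Sum>i<n. of_int (a i) * measure lborel (R i))"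
    by (intro sum.cong) auto
  finally show ?thesis by simp
qed

lemma weighted_area_eq:
  assumes "represents n a R f"
  shows "weighted_area f = (\<Sum>i<n. of_int (a i) * measure lborel (R i))"
  unfolding weighted_area_def
proof (rule the_equality)
  fix A assume "\<exists>n a R. represents n a R f \<and> A = (\<Sum>i<n. of_int (a i) * measure lborel (R i))"
  then show "A = (\<Sum>i<n. of_int (a i) * measure lborel (R i))"
    using represents_area[OF assms] represents_area by auto
qed (use assms in blast)

lemma measure_unit_square: "measure lborel (unit_square s) = 1"
proof -
  obtain i j where s: "s = (i, j)" by force
  have "emeasure lborel (unit_square s) =
    emeasure (lborel \<Otimes>\<^sub>M lborel) ({real_of_int i..<of_int i + 1} \<times> {real_of_int j..<of_int j + 1})"
    by (simp add: s unit_square_def lborel_prod)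
  also have "\<dots> = 1"
    by (subst lborel.emeasure_pair_measure_Times) auto
  finally show ?thesis by (simp add: measure_def)
qed

lemma lattice_tile_represents:
  assumes "finite {s. w s \<noteq> 0}"
  obtains n a R where "represents n a R (lattice_tile w)"
    "(\<Sum>i<n. of_int (a i) * measure lborel (R i)) = of_int (lattice_area w)"
proof -
  let ?S = "{s. w s \<noteq> 0}"
  obtain h where h: "bij_betw h {..<card ?S} ?S"
    using ex_bij_betw_nat_finite[OF assms] by (auto simp: lessThan_atLeast0)
  have rect: "is_rectangle (unit_square s)" for s
    unfolding is_rectangle_def unit_square_def case_prod_beta
    by (intro exI conjI refl) auto
  have "s = t" if "p \<in> unit_square s" "p \<in> unit_square t" for s t p
  proof -
    have "\<lfloor>fst p\<rfloor> = fst u \<and> \<lfloor>snd p\<rfloor> = snd u" if "p \<in> unit_square u" for u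
      using that by (auto simp: unit_square_def case_prod_beta floor_eq_iff)
    from this[OF that(1)] this[OF that(2)] show ?thesis by (simp add: prod_eq_iff)
  qed
  then have disj: "disjoint_family unit_square"
    unfolding disjoint_family_on_def by blast
  have disj: "disjoint_family_on (unit_square \<circ> h) {..<card ?S}"
    unfolding disjoint_family_on_def o_def
  proof (intro ballI impI)
    fix i j assume "i \<in> {..<card ?S}" "j \<in> {..<card ?S}" "i \<noteq> j"
    then have "h i \<noteq> h j" using h by (meson bij_betw_def inj_onD)
    then show "unit_square (h i) \<inter> unit_square (h j) = {}"
      by (rule disjoint_family_onD[OF disj UNIV_I UNIV_I])
  qed
  have "represents (card ?S) (w \<circ> h) (unit_square \<circ> h) (lattice_tile w)"
    unfolding represents_def lattice_tile_def
  proof (intro conjI ext)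
    fix p
    show "(\<Sum>s\<in>?S. w s * indicator (unit_square s) p) =
        (\<Sum>i<card ?S. (w \<circ> h) i * indicator ((unit_square \<circ> h) i) p)"
      using sum.reindex_bij_betw[OF h, of "\<lambda>s. w s * indicator (unit_square s) p"]
      by (simp only: o_def)
  qed (use rect disj in simp_all)
  moreover have "(\<Sum>i<card ?S. of_int ((w \<circ> h) i) * measure lborel ((unit_square \<circ> h) i)) = of_int (lattice_area w)"
    using sum.reindex_bij_betw[OF h, of "\<lambda>s. real_of_int (w s)"]
    by (simp add: measure_unit_square lattice_area_def)
  ultimately show ?thesis using that by blast
qed

lemma weighted_tile_lattice_tile: "finite {s. w s \<noteq> 0} \<Longrightarrow> weighted_tile (lattice_tile w)"
  by (erule lattice_tile_represents) (auto simp: weighted_tile_def)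

lemma weighted_area_lattice_tile:
  "finite {s. w s \<noteq> 0} \<Longrightarrow> weighted_area (lattice_tile w) = of_int (lattice_area w)"
  by (erule lattice_tile_represents) (simp add: weighted_area_eq)

end

theory Submission
  imports Defs "HOL-Library.Poly_Mapping" "HOL-Computational_Algebra.Polynomial"
begin

text \<open>
  Attach to a tile its corners in the group ring of \<open>\<real>\<^sup>2\<close>: a square of side \<open>r\<close> at the origin
  becomes \<open>E\<^sub>r = (X\<^sup>r - 1)(Y\<^sup>r - 1)\<close>, the dilated tile \<open>T(r)\<close> becomes \<open>p\<^sub>r E\<^sub>r\<close> with
  \<open>p\<^sub>r\<close> the sum of \<open>w\<^sub>i\<^sub>j X\<^bsup>r i\<^esup> Y\<^bsup>r j\<^esup>\<close>, and translations act as monomials. So a square can be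
  shapetiled if and only if some \<open>E\<^sub>r\<close>, up to a monomial, is in the ideal of all \<open>p\<^sub>r E\<^sub>r\<close>.

  Necessity: apply the additive functional \<open>X\<^sup>x Y\<^sup>y \<mapsto> x y\<close> (area) and the specialization
  \<open>X\<^sup>x Y\<^sup>y \<mapsto> Z\<^bsup>\<mu> x - y\<^esup>\<close>, which turns the \<open>p\<^sub>r\<close> into sums of slope class areas.

  Sufficiency: let \<open>I\<close> be the ideal of the \<open>p\<^sub>k\<close>, \<open>k \<ge> 1\<close> an integer. These are power sums of the
  monomials of \<open>T\<close>, so Lagrange interpolation puts the product of all differences of these monomials
  into \<open>I\<close>. Modulo one such difference, i.e. modulo \<open>X\<^sup>A Y\<^sup>B - 1\<close>, the \<open>p\<^sub>k\<close> with \<open>k\<close> a multiple of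
  \<open>A\<^sup>2 + B\<^sup>2\<close> are power sums weighted by the areas of slope classes; interpolating again shows
  that \<open>I\<close> contains a power of some \<open>E\<^sub>M\<close> (by the gcd condition) and a nonzero integer (since the
  area is not zero). After multiplication by \<open>E\<^sub>K\<close>, with \<open>K\<close> divisible enough, both
  \<open>b E\<^sub>K\<close> and \<open>E\<^sub>K\<^bsup>n+1\<^esup>\<close> are in the ideal of the \<open>p\<^sub>k E\<^sub>k\<close>, and then so is \<open>E\<^sub>r\<close> for
  \<open>r = K \<bar>b\<bar>\<^sup>n\<close>.
\<close>

section \<open>Ideals in commutative rings\<close>

interpretation ideal: module "(*) :: 'a::comm_ring_1 \<Rightarrow> 'a \<Rightarrow> 'a"
  by unfold_locales (auto simp: algebra_simps)

text \<open>As a rewrite rule for \<open>(*)\<close>, \<open>scale_scale\<close> loops together with associativity.\<close>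

declare ideal.scale_scale [simp del]

lemma ideal_mult_right: "x \<in> ideal.span G \<Longrightarrow> x * r \<in> ideal.span G"
  by (metis ideal.span_scale mult.commute)

lemma ideal_dvd: "x \<in> ideal.span G \<Longrightarrow> x dvd y \<Longrightarrow> y \<in> ideal.span G"
  by (auto elim!: dvdE intro: ideal_mult_right)

section \<open>Multiplicative sets meeting an ideal\<close>

definition mult_closed :: "'a::comm_ring_1 set \<Rightarrow> bool" where
  "mult_closed W \<longleftrightarrow> 1 \<in> W \<and> (\<forall>x\<in>W. \<forall>y\<in>W. x * y \<in> W)"

text \<open>By \<open>meets_prod\<close> below, this can be checked modulo each factor of a product that lies in
  the ideal.\<close>

definition meets :: "'a::comm_ring_1 set \<Rightarrow> 'a set \<Rightarrow> bool" where
  "meets W G \<longleftrightarrow> W \<inter> ideal.span G \<noteq> {}"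

lemma meetsI: "x \<in> W \<Longrightarrow> x \<in> ideal.span G \<Longrightarrow> meets W G"
  by (auto simp: meets_def)

text \<open>If \<open>x\<close> is \<open>a * f\<close> and \<open>y\<close> is \<open>b * g\<close>
  modulo the span of \<open>G\<close>, then \<open>x * y\<close> is a multiple of
  \<open>f * g\<close> modulo it.\<close>

lemma meets_insert_mult:
  assumes W: "mult_closed W" and f: "meets W (insert f G)" and g: "meets W (insert g G)"
  shows "meets W (insert (f * g) G)"
proof -
  obtain x y a b where x: "x \<in> W" "x - a * f \<in> ideal.span G"
    and y: "y \<in> W" "y - b * g \<in> ideal.span G"
    using f g by (auto simp: meets_def ideal.span_breakdown_eq)
  have "(x - a * f) * y + a * f * (y - b * g) \<in> ideal.span G"
    by (intro ideal.span_add ideal_mult_right ideal.span_scale x y)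
  also have "(x - a * f) * y + a * f * (y - b * g) = x * y - (a * b) * (f * g)"
    by (simp add: algebra_simps)
  finally have "x * y \<in> ideal.span (insert (f * g) G)"
    by (auto simp: ideal.span_breakdown_eq)
  moreover have "x * y \<in> W" using W x y by (auto simp: mult_closed_def)
  ultimately show ?thesis by (rule meetsI[rotated])
qed

lemma meets_insert_prod:
  assumes "mult_closed W" "finite A" "\<And>i. i \<in> A \<Longrightarrow> meets W (insert (f i) G)"
  shows "meets W (insert (prod f A) G)"
  using assms(2,3)
proof (induction A rule: finite_induct)
  case empty
  have "1 \<in> W" using assms(1) by (simp add: mult_closed_def)
  then show ?case by (rule meetsI) (simp add: ideal.span_base)
next
  case (insert i A)
  then show ?case by (simp add: meets_insert_mult[OF assms(1)])
qed

lemma meets_redundant: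
  assumes "meets W (insert g G)" "g \<in> ideal.span G"
  shows "meets W G"
proof -
  have "ideal.span (insert g G) \<subseteq> ideal.span G"
    using assms(2) by (intro ideal.span_minimal) (auto intro: ideal.span_base)
  then show ?thesis using assms(1) by (auto simp: meets_def)
qed

lemma meets_prod:
  assumes "mult_closed W" "finite A" "\<And>i. i \<in> A \<Longrightarrow> meets W (insert (f i) G)"
    and "prod f A \<in> ideal.span G"
  shows "meets W G"
  using meets_insert_prod[OF assms(1-3)] assms(4) by (rule meets_redundant)

lemma Gcd_int_mem:
  fixes K :: "int set"
  assumes "finite A" "A \<subseteq> K" "0 \<in> K" "\<And>x y u v. x \<in> K \<Longrightarrow> y \<in> K \<Longrightarrow> u * x + v * y \<in> K"
  shows "Gcd A \<in> K"
  using assms(1,2)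
proof (induction A rule: finite_induct)
  case (insert a A)
  obtain u v where "u * a + v * Gcd A = gcd a (Gcd A)" using bezout_int by blast
  then show ?case using assms(4)[of a "Gcd A" u v] insert by auto
qed (use assms in auto)

text \<open>For finite \<open>C\<close>, up to sign the discriminant of the monic polynomial with
  roots \<open>m c\<close>. Using all ordered pairs lets one element serve to isolate every
  weight.\<close>

definition root_diffs :: "('c \<Rightarrow> 'a::comm_ring_1) \<Rightarrow> 'c set \<Rightarrow> 'a" where
  "root_diffs m C = (\<Prod>(c, d)\<in>C \<times> C - Id. m c - m d)"

text \<open>Lagrange interpolation: a polynomial vanishing at \<open>0\<close> and at all \<open>m d\<close> with \<open>d \<noteq> c\<close>
  isolates the weight of \<open>c\<close> from the power sums.\<close>

lemma lagrange_isolate: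
  fixes m :: "'c \<Rightarrow> 'a::comm_ring_1"
  assumes C: "finite C" "c \<in> C"
    and sums: "\<And>t. t \<ge> 1 \<Longrightarrow> (\<Sum>d\<in>C. a d * m d ^ t) \<in> ideal.span G"
    and unit: "m c dvd 1"
  shows "a c * root_diffs m C \<in> ideal.span G"
proof -
  \<comment> \<open>The factor \<open>[:0, 1:]\<close> removes the constant coefficient, as power
    sums are given only for exponents \<open>t \<ge> 1\<close>. It costs a factor
    \<open>m c\<close>, cancelled below because \<open>m c\<close> is a unit.\<close>
  define q where "q = [:0, 1:] * (\<Prod>d\<in>C - {c}. [:- m d, 1:])"
  have q: "poly q x = x * (\<Prod>d\<in>C - {c}. x - m d)" for x
    by (simp add: q_def poly_prod)
  have "(\<Sum>d\<in>C. a d * poly q (m d)) = (\<Sum>d\<in>C. \<Sum>t\<le>degree q. coeff q t * (a d * m d ^ t))"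
    by (intro sum.cong refl) (simp only: poly_altdef sum_distrib_left mult.left_commute)
  also have "\<dots> = (\<Sum>t\<le>degree q. coeff q t * (\<Sum>d\<in>C. a d * m d ^ t))"
    by (subst sum.swap) (simp add: sum_distrib_left)
  also have "\<dots> \<in> ideal.span G"
  proof (rule ideal.span_sum)
    fix t
    have "coeff q 0 = 0" by (simp add: q_def)
    then show "coeff q t * (\<Sum>d\<in>C. a d * m d ^ t) \<in> ideal.span G"
      using ideal.span_scale[OF sums[of t], of "coeff q t"] ideal.span_zero[of G] by (cases "t = 0") auto
  qed
  also have "(\<Sum>d\<in>C. a d * poly q (m d)) = (\<Sum>d\<in>{c}. a d * poly q (m d))"
  proof (intro sum.mono_neutral_right ballI)
    fix i assume "i \<in> C - {c}"
    then have "(\<Prod>d\<in>C - {c}. m i - m d) = 0" using C by (intro prod_zero) auto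
    then show "a i * poly q (m i) = 0" by (simp add: q)
  qed (use C in auto)
  finally have mem: "a c * (m c * (\<Prod>d\<in>C - {c}. m c - m d)) \<in> ideal.span G"
    by (simp add: q)
  obtain u where u: "1 = m c * u" using unit by (rule dvdE)
  have "u * (a c * (m c * (\<Prod>d\<in>C - {c}. m c - m d))) = (m c * u) * (a c * (\<Prod>d\<in>C - {c}. m c - m d))"
    by (simp only: mult_ac)
  then have *: "a c * (\<Prod>d\<in>C - {c}. m c - m d) \<in> ideal.span G"
    using ideal.span_scale[OF mem, of u] by (simp add: u[symmetric])
  have "(\<Prod>d\<in>C - {c}. m c - m d) = (\<Prod>(c', d)\<in>{c} \<times> (C - {c}). m c' - m d)"
    by (subst prod.cartesian_product[symmetric]) simp
  also have "\<dots> dvd root_diffs m C"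
    unfolding root_diffs_def using C by (intro prod_dvd_prod_subset) auto
  finally show ?thesis by (rule ideal_dvd[OF * mult_dvd_mono[OF dvd_refl]])
qed

text \<open>The integers \<open>z\<close> with \<open>of_int z * root_diffs m C\<close> in the ideal
  are closed under integer combinations. They include every weight by
  \<open>lagrange_isolate\<close>, hence the gcd.\<close>

lemma root_diffs_mem:
  fixes m :: "'c \<Rightarrow> 'a::comm_ring_1"
  assumes "finite C" and "\<And>t. t \<ge> 1 \<Longrightarrow> (\<Sum>d\<in>C. of_int (a d) * m d ^ t) \<in> ideal.span G"
    and "\<And>c. c \<in> C \<Longrightarrow> m c dvd 1" and "Gcd (a ` C) = 1"
  shows "root_diffs m C \<in> ideal.span G"
proof -
  define K where "K = {z. of_int z * root_diffs m C \<in> ideal.span G}"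
  have "a ` C \<subseteq> K"
    unfolding K_def using assms
    by (intro image_subsetI CollectI lagrange_isolate[where a = "\<lambda>c. of_int (a c)"])
  moreover have "0 \<in> K" by (simp add: K_def ideal.span_zero)
  moreover have "u * x + v * y \<in> K" if "x \<in> K" "y \<in> K" for x y u v
  proof -
    have "of_int x * root_diffs m C \<in> ideal.span G" "of_int y * root_diffs m C \<in> ideal.span G"
      using that by (simp_all add: K_def)
    from ideal.span_add[OF ideal.span_scale[OF this(1), of "of_int u"] ideal.span_scale[OF this(2), of "of_int v"]]
    show ?thesis by (simp add: K_def distrib_right mult.assoc)
  qed
  ultimately have "Gcd (a ` C) \<in> K"
    by (rule Gcd_int_mem[OF finite_imageI[OF assms(1)]])
  then show ?thesis by (simp add: K_def assms(4))
qed

text \<open>With \<open>y = x ^ (m ^ n)\<close>, \<open>y ^ m - 1\<close> is \<open>y - 1\<close>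
  times a geometric sum that is \<open>m\<close> modulo \<open>y - 1\<close>, so each step
  contributes a factor \<open>m\<close> or one more factor \<open>x - 1\<close>.\<close>

lemma power_tower_minus_one:
  fixes x :: "'a::comm_ring_1"
  shows "\<exists>a b. x ^ (m ^ n) - 1 = (x - 1) * (of_nat m * a + (x - 1) ^ n * b)"
proof (induction n)
  case 0
  show ?case by (rule exI[of _ 0], rule exI[of _ 1]) simp
next
  case (Suc n)
  then obtain a b where IH: "x ^ (m ^ n) - 1 = (x - 1) * (of_nat m * a + (x - 1) ^ n * b)" by blast
  define y where "y = x ^ (m ^ n)"
  have "y - 1 dvd (\<Sum>i<m. y ^ i) - of_nat m"
  proof -
    have "(\<Sum>i<m. y ^ i) - of_nat m = (\<Sum>i<m. y ^ i - 1)" by (simp add: sum_subtractf)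
    also have "y - 1 dvd \<dots>" by (intro dvd_sum) (simp add: power_diff_1_eq)
    finally show ?thesis .
  qed
  then obtain c where c: "(\<Sum>i<m. y ^ i) = of_nat m + (y - 1) * c"
    by (auto elim!: dvdE simp: diff_eq_eq add.commute)
  define d where "d = of_nat m * a + (x - 1) ^ n * b"
  have y: "y - 1 = (x - 1) * d" using IH by (simp add: y_def d_def)
  have "x ^ (m ^ Suc n) - 1 = y ^ m - 1" by (simp add: y_def power_mult[symmetric] mult.commute)
  also have "\<dots> = (y - 1) * (of_nat m + (y - 1) * c)" by (simp only: power_diff_1_eq c)
  also have "\<dots> = (x - 1) * (of_nat m * d + (x - 1) * d * c * d)"
    by (simp only: y distrib_left mult_ac)
  also have "(x - 1) * d * c * d = (x - 1) * d * c * (of_nat m * a + (x - 1) ^ n * b)"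
    by (simp only: d_def[symmetric])
  also have "of_nat m * d + \<dots> =
      of_nat m * (d + (x - 1) * d * c * a) + (x - 1) ^ Suc n * (d * c * b)"
    by (simp only: distrib_left mult_ac add.assoc power_Suc)
  finally show ?case by blast
qed

section \<open>Tiles and the group ring of the plane\<close>

text \<open>The group ring of the plane, an element \<open>mon (a, b)\<close> standing for \<open>X\<^sup>a Y\<^sup>b\<close>.\<close>

type_synonym plane_ring = "(real \<times> real, int) poly_mapping"

abbreviation mon :: "real \<times> real \<Rightarrow> plane_ring" where
  "mon v \<equiv> Poly_Mapping.single v 1"

lemma mon_add: "mon (u + v) = mon u * mon v"
  by (simp add: mult_single)

lemma mon_scaleR_power: "mon (real n *\<^sub>R v) = mon v ^ n"
  by (induction n) (simp_all add: scaleR_add_left mon_add zero_prod_def[symmetric])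

lemma mon_mult_inverse: "mon v * mon (- v) = 1"
  by (simp add: mult_single)

lemma mon_dvd_one: "mon v dvd 1"
  by (metis mon_mult_inverse dvd_triv_left)

text \<open>The additive extension of \<open>h\<close> from monomials to the group ring.\<close>

definition pair :: "(real \<times> real \<Rightarrow> 'b::comm_ring_1) \<Rightarrow> plane_ring \<Rightarrow> 'b" where
  "pair h g = (\<Sum>v\<in>Poly_Mapping.keys g. of_int (Poly_Mapping.lookup g v) * h v)"

lemma pair_zero [simp]: "pair h 0 = 0"
  by (simp add: pair_def)

lemma pair_mon [simp]: "pair h (mon v) = h v"
  by (simp add: pair_def)

lemma pair_one [simp]: "pair h 1 = h 0"
  by (simp add: pair_def)

lemma pair_add: "pair h (f + g) = pair h f + pair h g"
  unfolding pair_def by (rule setsum_keys_plus_distrib) (auto simp: distrib_right)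

lemma pair_uminus: "pair h (- g) = - pair h g"
  by (simp add: pair_def sum_negf)

lemma pair_diff: "pair h (f - g) = pair h f - pair h g"
  using pair_add[of h f "- g"] by (simp add: pair_uminus)

lemma pair_sum: "pair h (\<Sum>i\<in>I. g i) = (\<Sum>i\<in>I. pair h (g i))"
  by (induction I rule: infinite_finite_induct) (simp_all add: pair_add)

lemma pair_of_int_mult: "pair h (of_int a * g) = of_int a * pair h g"
proof -
  have nat: "pair h (of_nat n * g) = of_nat n * pair h g" for n
    by (induction n) (simp_all add: distrib_right pair_add)
  show ?thesis
    by (cases a rule: int_cases2) (simp_all add: nat pair_uminus)
qed

lemma pair_mon_mult: "pair h (mon v * g) = pair (\<lambda>u. h (v + u)) g"
proof -
  have "Poly_Mapping.keys g \<subseteq> UNIV" by simp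
  then show ?thesis
    by (induction g rule: frag_induction)
      (simp_all add: mult_single right_diff_distrib pair_diff)
qed

text \<open>The convolution action on tiles, in which \<open>mon v\<close> translates by
  \<open>v\<close>.\<close>

definition act :: "plane_ring \<Rightarrow> tile \<Rightarrow> tile" where
  "act g F = (\<lambda>p. pair (\<lambda>v. F (p - v)) g)"

lemma act_add: "act (f + g) F p = act f F p + act g F p"
  by (simp add: act_def pair_add)

lemma act_diff: "act (f - g) F p = act f F p - act g F p"
  by (simp add: act_def pair_diff)

lemma act_sum: "act (\<Sum>i\<in>I. g i) F p = (\<Sum>i\<in>I. act (g i) F p)"
  by (simp add: act_def pair_sum)

lemma act_of_int_mult: "act (of_int a * g) F p = a * act g F p"
  by (simp add: act_def pair_of_int_mult)

lemma act_mon_mult: "act (mon v * g) F = translate v (act g F)"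
  by (simp add: act_def translate_def pair_mon_mult diff_diff_eq)

text \<open>Quadrants placed at the four corners with alternating signs add up to a square; the
  closed left and lower edges match half-open squares.\<close>

definition quadrant :: tile where
  "quadrant = indicator ({0..} \<times> {0..})"

text \<open>At the lexicographically least element of the support of \<open>g\<close> no other term contributes.\<close>

lemma act_quadrant_eq_0:
  assumes "act g quadrant = (\<lambda>p. 0)"
  shows "g = 0"
proof (rule ccontr)
  let ?K = "Poly_Mapping.keys g"
  assume "g \<noteq> 0"
  then have ne: "?K \<noteq> {}" by simp
  define x where "x = Min (fst ` ?K)"
  define y where "y = Min (snd ` {v \<in> ?K. fst v = x})"
  have "x \<in> fst ` ?K" unfolding x_def using ne by (intro Min_in) auto
  then have ne': "{v \<in> ?K. fst v = x} \<noteq> {}" by auto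
  then have "y \<in> snd ` {v \<in> ?K. fst v = x}" unfolding y_def by (intro Min_in) auto
  then have xy: "(x, y) \<in> ?K" by auto
  have x: "x \<le> fst v" if "v \<in> ?K" for v
    unfolding x_def using that by simp
  have y: "y \<le> snd v" if "v \<in> ?K" "fst v = x" for v
    unfolding y_def using that by (intro Min_le) auto
  have q: "quadrant ((x, y) - v) = (if v = (x, y) then 1 else 0)" if "v \<in> ?K" for v
    using x[OF that] y[OF that] by (cases v) (auto simp: quadrant_def indicator_def)
  have "act g quadrant (x, y) = (\<Sum>v\<in>?K. if v = (x, y) then Poly_Mapping.lookup g v else 0)"
    unfolding act_def pair_def by (intro sum.cong) (auto simp: q)
  also have "\<dots> = Poly_Mapping.lookup g (x, y)" using xy by simp
  finally show False using assms xy by (simp add: in_keys_iff)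
qed

lemma act_quadrant_inject:
  assumes "act f quadrant = act g quadrant"
  shows "f = g"
  using act_quadrant_eq_0[of "f - g"] assms by (simp add: act_diff fun_eq_iff)

section \<open>Squares and dilated lattice tiles as group ring elements\<close>

definition box_elem :: "real \<Rightarrow> plane_ring" where
  "box_elem r = (mon (r, 0) - 1) * (mon (0, r) - 1)"

definition lattice_vec :: "int \<times> int \<Rightarrow> real \<times> real" where
  "lattice_vec s = (of_int (fst s), of_int (snd s))"

definition weight_elem :: "(int \<times> int \<Rightarrow> int) \<Rightarrow> real \<Rightarrow> plane_ring" where
  "weight_elem w r = (\<Sum>s | w s \<noteq> 0. of_int (w s) * mon (r *\<^sub>R lattice_vec s))"

lemma pair_box_elem: "pair h (box_elem r) = h (r, r) - h (r, 0) - h (0, r) + h 0"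
proof -
  have "box_elem r = mon (r, r) - mon (r, 0) - mon (0, r) + 1"
    by (simp add: box_elem_def algebra_simps mult_single)
  then show ?thesis by (simp add: pair_add pair_diff)
qed

lemma pair_mon_box_elem:
  "pair h (mon (x, y) * box_elem r) = h (x + r, y + r) - h (x + r, y) - h (x, y + r) + h (x, y)"
  by (simp add: pair_mon_mult pair_box_elem)

lemma pair_weight_elem_mult:
  "pair h (weight_elem w r * g) = (\<Sum>s | w s \<noteq> 0. of_int (w s) * pair h (mon (r *\<^sub>R lattice_vec s) * g))"
  by (simp add: weight_elem_def sum_distrib_right pair_sum mult.assoc pair_of_int_mult)

lemma act_box_elem:
  assumes "s > 0"
  shows "act (mon (b, c) * box_elem s) quadrant = indicator ({b..<b + s} \<times> {c..<c + s})"
  using assms by (auto simp: fun_eq_iff act_def pair_mon_box_elem quadrant_def indicator_def)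

lemma dilate_lattice_tile:
  assumes r: "r > 0"
  shows "dilate r (lattice_tile w) = act (weight_elem w r * box_elem r) quadrant"
proof (intro ext, clarify)
  fix x y
  have "indicator (unit_square s) (x / r, y / r) =
      act (mon (r *\<^sub>R lattice_vec s) * box_elem r) quadrant (x, y)" for s
    unfolding lattice_vec_def scaleR_Pair act_box_elem[OF r] using r
    by (simp add: unit_square_def case_prod_beta indicator_def field_simps)
  then show "dilate r (lattice_tile w) (x, y) = act (weight_elem w r * box_elem r) quadrant (x, y)"
    by (simp add: dilate_def lattice_tile_def act_def pair_weight_elem_mult)
qed

section \<open>Tilings and ideal membership\<close>

lemma Z_tiles_zero: "Z_tiles \<T> (\<lambda>p. 0)"
  unfolding Z_tiles_def by (rule exI[of _ 0]) simp

lemma Z_tiles_add_tile: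
  assumes U: "Z_tiles \<T> U" and T: "T \<in> \<T>"
  shows "Z_tiles \<T> (\<lambda>p. a * translate v T p + U p)"
proof -
  obtain n :: nat and b :: "nat \<Rightarrow> int" and \<tau> :: "nat \<Rightarrow> tile"
    where 1: "\<forall>i<n. \<exists>T\<in>\<T>. \<exists>v. \<tau> i = translate v T"
    and 2: "(\<lambda>p. \<Sum>i<n. b i * \<tau> i p) = U"
    using U unfolding Z_tiles_def by blast
  have "(\<lambda>p. \<Sum>i<Suc n. (b(n := a)) i * (\<tau>(n := translate v T)) i p) = (\<lambda>p. a * translate v T p + U p)"
    unfolding 2[symmetric] by (simp add: add.commute)
  moreover have "\<exists>T'\<in>\<T>. \<exists>v'. (\<tau>(n := translate v T)) i = translate v' T'" if "i < Suc n" for i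
    using that T 1 by (auto simp: less_Suc_eq simp del: split_paired_Ex)
  ultimately show ?thesis unfolding Z_tiles_def by blast
qed

text \<open>Since \<open>frag_induction\<close> builds elements by differences, the claim is
  strengthened: adding or subtracting \<open>g\<close> preserves \<open>P\<close>.\<close>

lemma mon_induct [case_names zero add]:
  assumes "P 0" "\<And>a v g. P g \<Longrightarrow> P (of_int a * mon v + g)"
  shows "P (g :: plane_ring)"
proof -
  have "Poly_Mapping.keys g \<subseteq> UNIV" by simp
  then have "\<forall>f. P f \<longrightarrow> P (f + g) \<and> P (f - g)"
  proof (induction g rule: frag_induction)
    case (one v)
    show ?case using assms(2)[of _ 1 v] assms(2)[of _ "-1" v] by (auto simp: add.commute)
  next
    case (diff a b)
    then show ?case by (metis add_diff_eq diff_add_eq diff_diff_eq2)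
  qed auto
  then show ?thesis using assms(1) by (metis add_0)
qed

text \<open>A ring coefficient is an integer combination of translations, so an ideal combination of
  generators reads as a tiling.\<close>

lemma Z_tiles_act:
  assumes "x \<in> ideal.span G" and G: "\<And>g. g \<in> G \<Longrightarrow> act g F \<in> \<T>"
  shows "Z_tiles \<T> (act x F)"
  using assms(1)
proof (induction rule: ideal.span_induct_alt)
  case base
  then show ?case by (simp add: act_def Z_tiles_zero)
next
  case (step c g y)
  show ?case
  proof (induction c rule: mon_induct)
    case zero
    then show ?case using step by simp
  next
    case (add a v c)
    have "act ((of_int a * mon v + c) * g + y) F = (\<lambda>p. a * translate v (act g F) p + act (c * g + y) F p)"
      by (simp add: fun_eq_iff distrib_right add.assoc act_add act_of_int_mult mult.assoc act_mon_mult)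
    then show ?case using Z_tiles_add_tile[OF add G[OF step(1)]] by simp
  qed
qed

section \<open>Necessity\<close>

definition slope_level :: "real \<Rightarrow> int \<times> int \<Rightarrow> real" where
  "slope_level \<mu> s = \<mu> * of_int (fst s) - of_int (snd s)"

lemma slope_rel_iff: "(s, t) \<in> slope_rel \<mu> \<longleftrightarrow> slope_level \<mu> s = slope_level \<mu> t"
  by (cases s; cases t; cases "fst s = fst t")
    (auto simp: slope_rel_def line_slope_def center_def slope_level_def divide_eq_eq algebra_simps)

lemma lattice_area_slope_classes:
  "lattice_area ` slope_classes \<mu> w =
    (\<lambda>e. \<Sum>s | w s \<noteq> 0 \<and> slope_level \<mu> s = e. w s) ` slope_level \<mu> ` {s. w s \<noteq> 0}"
proof -
  have cl: "slope_rel \<mu> `` {s} = {t. slope_level \<mu> t = slope_level \<mu> s}" for s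
    by (auto simp: slope_rel_iff)
  have area: "lattice_area (\<lambda>s. if slope_level \<mu> s = e then w s else 0) =
      (\<Sum>s | w s \<noteq> 0 \<and> slope_level \<mu> s = e. w s)" for e
    unfolding lattice_area_def by (intro sum.cong) auto
  have "slope_classes \<mu> w = (\<lambda>e s. if s \<in> {t. slope_level \<mu> t = e} then w s else 0) `
      slope_level \<mu> ` {s. w s \<noteq> 0}"
    (is "_ = ?f ` _ ` ?S")
  proof (intro equalityI subsetI)
    fix f assume "f \<in> slope_classes \<mu> w"
    then obtain s t where f: "f = ?f (slope_level \<mu> s)"
      and t: "slope_level \<mu> t = slope_level \<mu> s" "w t \<noteq> 0"
      unfolding slope_classes_def quotient_def cl by auto
    have "f = ?f (slope_level \<mu> t)" by (simp only: f t)
    then show "f \<in> ?f ` slope_level \<mu> ` ?S" using t by blast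
  next
    fix f assume "f \<in> ?f ` slope_level \<mu> ` ?S"
    then obtain s where "w s \<noteq> 0" "f = ?f (slope_level \<mu> s)" by blast
    then show "f \<in> slope_classes \<mu> w"
      unfolding slope_classes_def quotient_def cl by blast
  qed
  then show ?thesis by (simp only: image_image area mem_Collect_eq)
qed

text \<open>As \<open>r\<close> is nonzero, the condition selects the single level
  \<open>(t - u) / r\<close>.\<close>

lemma dvd_slope_level_sum:
  assumes "finite {s. w s \<noteq> (0::int)}" "\<And>e. d dvd (\<Sum>s | w s \<noteq> 0 \<and> slope_level \<mu> s = e. w s)" "r > 0"
  shows "d dvd (\<Sum>s | w s \<noteq> 0. w s * (if slope_level \<mu> s * r + u = t then 1 else 0))"
proof -
  have "(\<Sum>s | w s \<noteq> 0. w s * (if slope_level \<mu> s * r + u = t then 1 else 0)) =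
      (\<Sum>s | w s \<noteq> 0 \<and> slope_level \<mu> s = (t - u) / r. w s)"
    using assms(1,3) by (intro sum.mono_neutral_cong_right) (auto simp: field_simps)
  then show ?thesis using assms(2) by simp
qed

text \<open>The action on \<open>quadrant\<close> determines a ring element, so an equality of tiles
  lifts to the group ring.\<close>

lemma square_shapetiled_elem:
  assumes "is_square Q" "Z_shapetiles (lattice_tile w) (indicator Q)"
  obtains n a v r b s where "s > 0" "\<And>i. i < n \<Longrightarrow> r i > 0"
    "mon b * box_elem s = (\<Sum>i<n::nat. of_int (a i) * (mon (v i) * (weight_elem w (r i) * box_elem (r i))))"
proof -
  obtain b c s where s: "s > 0" and Q: "Q = {b..<b + s} \<times> {c..<c + s}"
  proof -
    obtain b1 b2 c1 c2 where "b1 < b2" "b2 - b1 = c2 - c1" "Q = {b1..<b2} \<times> {c1..<c2}"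
      using assms(1) by (auto simp: is_square_def)
    moreover from this have "b2 = b1 + (b2 - b1)" "c2 = c1 + (b2 - b1)" by auto
    ultimately show ?thesis using that[of "b2 - b1" b1 c1] by simp
  qed
  obtain n :: nat and a :: "nat \<Rightarrow> int" and \<tau> :: "nat \<Rightarrow> tile"
    where \<tau>: "\<forall>i<n. \<exists>T\<in>{dilate \<rho> (lattice_tile w) |\<rho>. \<rho> > 0}. \<exists>v. \<tau> i = translate v T"
    and sum: "(\<lambda>p. \<Sum>i<n. a i * \<tau> i p) = indicator Q"
    using assms(2) unfolding Z_shapetiles_def Z_tiles_def by blast
  have "\<forall>i. \<exists>x. i < n \<longrightarrow> fst x > 0 \<and> \<tau> i = translate (snd x) (dilate (fst x) (lattice_tile w))"
    using \<tau> by fastforce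
  then obtain x where x: "\<And>i. i < n \<Longrightarrow> fst (x i) > 0 \<and>
      \<tau> i = translate (snd (x i)) (dilate (fst (x i)) (lattice_tile w))"
    by metis
  define z where "z = (\<Sum>i<n. of_int (a i) * (mon (snd (x i)) *
      (weight_elem w (fst (x i)) * box_elem (fst (x i)))))"
  have "act (mon (b, c) * box_elem s) quadrant p = act z quadrant p" for p
  proof -
    have "act (mon (b, c) * box_elem s) quadrant p = (\<Sum>i<n. a i * \<tau> i p)"
      unfolding act_box_elem[OF s] Q[symmetric] sum[symmetric] ..
    also have "\<dots> = act z quadrant p"
      unfolding z_def act_sum act_of_int_mult act_mon_mult
      by (intro sum.cong refl) (simp add: x dilate_lattice_tile[symmetric])
    finally show ?thesis .
  qed
  then have "mon (b, c) * box_elem s = z" by (intro act_quadrant_inject ext)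
  then show ?thesis
    using that[of s n "\<lambda>i. fst (x i)" "(b, c)" a "\<lambda>i. snd (x i)"] s x by (simp add: z_def)
qed

text \<open>The mixed difference of \<open>h\<close> over a square of side \<open>r\<close> is
  \<open>r\<^sup>2\<close> at any position. So dilates of the tile pair to multiples of its area,
  while a square pairs to a nonzero number.\<close>

lemma shapetiles_square_imp_area:
  assumes "is_square Q" "Z_shapetiles (lattice_tile w) (indicator Q)"
  shows "lattice_area w \<noteq> 0"
proof
  assume 0: "lattice_area w = 0"
  obtain n a v r b s where s: "s > 0" and "\<And>i. i < n \<Longrightarrow> r i > 0"
    and eq: "mon b * box_elem s = (\<Sum>i<n::nat. of_int (a i) * (mon (v i) * (weight_elem w (r i) * box_elem (r i))))"
    by (rule square_shapetiled_elem[OF assms]) (rule that)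
  define h :: "real \<times> real \<Rightarrow> real" where "h p = fst p * snd p" for p
  have box: "pair h (mon u * box_elem r) = r\<^sup>2" for u r
    by (cases u) (simp only: pair_mon_box_elem h_def fst_conv snd_conv, simp add: algebra_simps power2_eq_square)
  have "pair h (mon u * (weight_elem w r * box_elem r)) = 0" for u r
  proof -
    have "pair h (mon u * (weight_elem w r * box_elem r)) =
        (\<Sum>s | w s \<noteq> 0. of_int (w s) * pair h (mon (r *\<^sub>R lattice_vec s + u) * box_elem r))"
      by (simp only: mult.left_commute[of "mon u"] pair_weight_elem_mult mon_add mult.assoc)
    also have "\<dots> = r\<^sup>2 * of_int (lattice_area w)"
      unfolding box lattice_area_def sum_distrib_right[symmetric] of_int_sum by (rule mult.commute)
    finally show ?thesis by (simp add: 0)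
  qed
  then have "pair h (mon b * box_elem s) = 0"
    unfolding eq pair_sum pair_of_int_mult by simp
  then show False using s by (simp add: box)
qed

text \<open>Setting \<open>X\<^sup>x Y\<^sup>y\<close> to \<open>Z\<close> to the power \<open>\<mu> x - y\<close> collapses each slope class; the
  functionals below read off single coefficients of the image. The image of a square has an
  extremal term, which does not cancel.\<close>

lemma shapetiles_square_imp_Gcd:
  assumes fin: "finite {s. w s \<noteq> 0}" and "is_square Q" "Z_shapetiles (lattice_tile w) (indicator Q)"
    and \<mu>: "\<mu> \<noteq> 0"
  shows "Gcd (lattice_area ` slope_classes \<mu> w) = 1"
proof -
  define d where "d = Gcd (lattice_area ` slope_classes \<mu> w)"
  have d: "d dvd (\<Sum>s | w s \<noteq> 0 \<and> slope_level \<mu> s = e. w s)" for e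
  proof (cases "e \<in> slope_level \<mu> ` {s. w s \<noteq> 0}")
    case True
    then show ?thesis unfolding d_def lattice_area_slope_classes by (intro Gcd_dvd imageI)
  next
    case False
    then have "{s. w s \<noteq> 0 \<and> slope_level \<mu> s = e} = {}" by auto
    then show ?thesis by (simp only: sum.empty dvd_0_right)
  qed
  obtain n a v r b s where s: "s > 0" and r: "\<And>i. i < n \<Longrightarrow> r i > 0"
    and eq: "mon b * box_elem s = (\<Sum>i<n::nat. of_int (a i) * (mon (v i) * (weight_elem w (r i) * box_elem (r i))))"
    by (rule square_shapetiled_elem[OF assms(2,3)]) (rule that)
  define L where "L p = \<mu> * fst p - snd p" for p :: "real \<times> real"
  define h :: "real \<Rightarrow> real \<times> real \<Rightarrow> int" where "h t p = (if L p = t then 1 else 0)" for t p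
  have 1: "d dvd pair (h t) (mon u * (weight_elem w r * box_elem r))" if "r > 0" for t u r
  proof -
    have *: "d dvd (\<Sum>s | w s \<noteq> 0. w s * h t (r *\<^sub>R lattice_vec s + u'))" for u'
      using dvd_slope_level_sum[OF fin d that, of "L u'" t]
      by (simp add: h_def L_def slope_level_def lattice_vec_def algebra_simps)
    have "pair (h t) (mon u * (weight_elem w r * box_elem r)) =
        (\<Sum>s | w s \<noteq> 0. w s * pair (h t) (mon (r *\<^sub>R lattice_vec s + u) * box_elem r))"
      by (simp only: mult.left_commute[of "mon u"] pair_weight_elem_mult mon_add mult.assoc of_int_eq_id id_apply)
    also have "\<dots> =
        (\<Sum>s | w s \<noteq> 0. w s * h t (r *\<^sub>R lattice_vec s + (u + (r, r)))) -
        (\<Sum>s | w s \<noteq> 0. w s * h t (r *\<^sub>R lattice_vec s + (u + (r, 0)))) -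
        (\<Sum>s | w s \<noteq> 0. w s * h t (r *\<^sub>R lattice_vec s + (u + (0, r)))) +
        (\<Sum>s | w s \<noteq> 0. w s * h t (r *\<^sub>R lattice_vec s + (u + 0)))"
      by (simp only: pair_mon_mult pair_box_elem add.assoc right_diff_distrib distrib_left
          sum_subtractf sum.distrib)
    also have "d dvd \<dots>" by (intro dvd_add dvd_diff *)
    finally show ?thesis .
  qed
  have "d dvd pair (h t) (mon b * box_elem s)" for t
    unfolding eq pair_sum pair_of_int_mult by (intro dvd_sum) (simp add: 1 r)
  then have 2: "d dvd h t (b + (s, s)) - h t (b + (s, 0)) - h t (b + (0, s)) + h t b" for t
    by (simp add: pair_mon_mult pair_box_elem)
  \<comment> \<open>Exactly one corner maximizes \<open>L\<close>: the lower right one if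
    \<open>\<mu> > 0\<close>, the lower left one if \<open>\<mu> < 0\<close>. At its level the
    alternating sum is -1 or 1.\<close>
  have "d dvd 1"
  proof (cases "\<mu> > 0")
    case True
    then have "\<mu> * s > 0" using s by simp
    then show ?thesis using 2[of "L (b + (s, 0))"] s \<mu>
      by (simp add: h_def L_def distrib_left)
  next
    case False
    then have "\<mu> * s < 0" using s \<mu> by (simp add: mult_less_0_iff)
    then show ?thesis using 2[of "L b"] s False \<mu>
      by (simp add: h_def L_def distrib_left)
  qed
  then show ?thesis by (simp add: d_def)
qed

section \<open>Sufficiency\<close>

text \<open>The vectors whose monomials become 1 modulo the ideal. They form a subgroup of the
  plane, so congruences of monomials reduce to integer combinations of vectors.\<close>

definition period :: "plane_ring set \<Rightarrow> (real \<times> real) set" where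
  "period G = {u. mon u - 1 \<in> ideal.span G}"

lemma period_diff_iff: "u - v \<in> period G \<longleftrightarrow> mon u - mon v \<in> ideal.span G"
proof -
  have 1: "mon u - mon v = mon v * (mon (u - v) - 1)"
    by (simp add: right_diff_distrib mult_single)
  have 2: "mon (u - v) - 1 = mon (- v) * (mon u - mon v)"
    by (simp add: right_diff_distrib mult_single)
  show ?thesis
    unfolding period_def mem_Collect_eq by (metis 1 2 ideal.span_scale)
qed

lemma period_zero: "0 \<in> period G"
  by (simp add: period_def ideal.span_zero)

lemma period_add:
  assumes "u \<in> period G" "v \<in> period G"
  shows "u + v \<in> period G"
proof -
  have "mon u * (mon v - 1) + (mon u - 1) \<in> ideal.span G"
    using assms unfolding period_def by (intro ideal.span_add ideal.span_scale) auto
  then show ?thesis by (simp add: period_def mon_add right_diff_distrib)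
qed

lemma period_uminus:
  assumes "u \<in> period G"
  shows "- u \<in> period G"
proof -
  have "mon 0 - mon u = - (mon u - 1)" by simp
  also have "\<dots> \<in> ideal.span G"
    using assms by (intro ideal.span_neg) (simp add: period_def)
  finally have "0 - u \<in> period G" by (simp only: period_diff_iff)
  then show ?thesis by simp
qed

lemma period_scale:
  assumes "u \<in> period G"
  shows "of_int k *\<^sub>R u \<in> period G"
proof -
  have nat: "real n *\<^sub>R u \<in> period G" for n
    by (induction n) (simp_all add: period_zero scaleR_add_left period_add assms)
  show ?thesis
    using nat period_uminus[OF nat] by (cases k rule: int_cases2) auto
qed

lemma period_mono: "G \<subseteq> H \<Longrightarrow> period G \<subseteq> period H"
  unfolding period_def using ideal.span_mono by blast

section \<open>Power sums modulo a period\<close>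

definition weight_elems :: "(int \<times> int \<Rightarrow> int) \<Rightarrow> plane_ring set" where
  "weight_elems w = {weight_elem w (real k) |k::nat. k \<ge> 1}"

text \<open>The determinant of \<open>(A, B)\<close> and \<open>s\<close>: an integer form of
  \<open>slope_level\<close> that also covers \<open>A = 0\<close>.\<close>

definition cross_level :: "int \<Rightarrow> int \<Rightarrow> int \<times> int \<Rightarrow> int" where
  "cross_level A B s = A * snd s - B * fst s"

definition cross_weight :: "int \<Rightarrow> int \<Rightarrow> (int \<times> int \<Rightarrow> int) \<Rightarrow> int \<Rightarrow> int" where
  "cross_weight A B w e = (\<Sum>s | w s \<noteq> 0 \<and> cross_level A B s = e. w s)"

definition cross_mon :: "int \<Rightarrow> int \<Rightarrow> int \<Rightarrow> plane_ring" where
  "cross_mon A B e = mon (of_int e *\<^sub>R (- of_int B, of_int A))"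

lemma cross_mon_dvd_one: "cross_mon A B e dvd 1"
  unfolding cross_mon_def by (rule mon_dvd_one)

text \<open>Dilation by \<open>A\<^sup>2 + B\<^sup>2\<close> turns every lattice vector into an integer combination of the period
  \<open>(A, B)\<close> and the orthogonal vector \<open>(-B, A)\<close>, so that whole slope classes collapse.\<close>

lemma cross_power_sum:
  assumes fin: "finite {s. w s \<noteq> 0}" and G: "weight_elems w \<subseteq> ideal.span G"
    and AB: "(of_int A, of_int B) \<in> period G" "(A, B) \<noteq> (0, 0)" and t: "t \<ge> 1"
  shows "(\<Sum>e\<in>cross_level A B ` {s. w s \<noteq> 0}. of_int (cross_weight A B w e) * cross_mon A B e ^ t)
    \<in> ideal.span G"
proof -
  let ?S = "{s. w s \<noteq> 0}"
  define k where "k = nat (A\<^sup>2 + B\<^sup>2)"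
  have k: "real k = of_int A ^ 2 + of_int B ^ 2" by (simp add: k_def)
  have "A\<^sup>2 + B\<^sup>2 > 0" using AB(2) by (simp add: sum_power2_gt_zero_iff)
  then have "k > 0" by (simp add: k_def)
  then have "weight_elem w (real (k * t)) \<in> ideal.span G"
    using G t unfolding weight_elems_def by (intro subsetD[OF G]) (auto simp: weight_elems_def intro!: exI[of _ "k * t"])
  moreover have "weight_elem w (real (k * t)) - (\<Sum>s\<in>?S. of_int (w s) * cross_mon A B (cross_level A B s) ^ t)
      \<in> ideal.span G"
    unfolding weight_elem_def sum_subtractf[symmetric] right_diff_distrib[symmetric]
  proof (intro ideal.span_sum ideal.span_scale)
    fix s
    have "real (k * t) *\<^sub>R lattice_vec s -
        real t *\<^sub>R (of_int (cross_level A B s) *\<^sub>R (- of_int B, of_int A)) =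
        of_int (int t * (A * fst s + B * snd s)) *\<^sub>R (of_int A, of_int B)"
      by (simp add: lattice_vec_def cross_level_def k algebra_simps power2_eq_square)
    also have "\<dots> \<in> period G" by (rule period_scale[OF AB(1)])
    finally show "mon (real (k * t) *\<^sub>R lattice_vec s) - cross_mon A B (cross_level A B s) ^ t
        \<in> ideal.span G"
      by (simp only: period_diff_iff cross_mon_def mon_scaleR_power[symmetric])
  qed
  ultimately have "weight_elem w (real (k * t)) - (weight_elem w (real (k * t)) -
      (\<Sum>s\<in>?S. of_int (w s) * cross_mon A B (cross_level A B s) ^ t)) \<in> ideal.span G"
    by (rule ideal.span_diff)
  also have "weight_elem w (real (k * t)) - (weight_elem w (real (k * t)) -
      (\<Sum>s\<in>?S. of_int (w s) * cross_mon A B (cross_level A B s) ^ t)) =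
      (\<Sum>s\<in>?S. of_int (w s) * cross_mon A B (cross_level A B s) ^ t)"
    by simp
  also have "\<dots> = (\<Sum>e\<in>cross_level A B ` ?S. \<Sum>s\<in>{s \<in> ?S. cross_level A B s = e}.
      of_int (w s) * cross_mon A B (cross_level A B s) ^ t)"
    by (rule sum.image_gen[OF fin])
  also have "\<dots> = (\<Sum>e\<in>cross_level A B ` ?S. of_int (cross_weight A B w e) * cross_mon A B e ^ t)"
    unfolding cross_weight_def of_int_sum sum_distrib_right
    by (intro sum.cong refl) auto
  finally show ?thesis .
qed

lemma cross_weight_image:
  assumes "A \<noteq> 0"
  shows "cross_weight A B w ` cross_level A B ` {s. w s \<noteq> 0} =
    lattice_area ` slope_classes (of_int B / of_int A) w"
proof -
  have "cross_level A B s = cross_level A B t \<longleftrightarrow>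
      slope_level (of_int B / of_int A) s = slope_level (of_int B / of_int A) t" for s t
  proof -
    have "real_of_int (cross_level A B s) = - of_int A * slope_level (of_int B / of_int A) s" for s
      using assms by (simp add: cross_level_def slope_level_def field_simps)
    then have "real_of_int (cross_level A B s) = of_int (cross_level A B t) \<longleftrightarrow>
        slope_level (of_int B / of_int A) s = slope_level (of_int B / of_int A) t"
      using assms by simp
    then show ?thesis by simp
  qed
  then show ?thesis
    unfolding lattice_area_slope_classes image_image cross_weight_def by simp
qed

text \<open>The periods \<open>(A, B)\<close> and \<open>d (-B, A)\<close> span a lattice that contains a multiple of \<open>\<int>\<^sup>2\<close>.\<close>

lemma cross_mon_diff_period:
  assumes AB: "(of_int A, of_int B) \<in> period G" "(A, B) \<noteq> (0, 0)" and "d \<noteq> e"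
    and "cross_mon A B d - cross_mon A B e \<in> ideal.span G"
  obtains c :: int where "c \<noteq> 0" "(of_int c, 0) \<in> period G" "(0, of_int c) \<in> period G"
proof
  let ?v = "of_int d *\<^sub>R (- of_int B, of_int A) - of_int e *\<^sub>R (- of_int B, of_int A) :: real \<times> real"
  \<comment> \<open>\<open>c\<close> is the determinant of the periods \<open>(A, B)\<close> and
    \<open>?v\<close>; the combinations below are Cramer's rule with denominators cleared.\<close>
  define c where "c = (A\<^sup>2 + B\<^sup>2) * (d - e)"
  have "A\<^sup>2 + B\<^sup>2 > 0" using AB(2) by (simp add: sum_power2_gt_zero_iff)
  then have "A\<^sup>2 + B\<^sup>2 \<noteq> 0" by linarith
  then show "c \<noteq> 0" using assms(3) unfolding c_def by (simp only: mult_eq_0_iff right_minus_eq) simp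
  have v: "?v \<in> period G" using assms(4) by (simp only: period_diff_iff cross_mon_def)
  have "of_int ((d - e) * A) *\<^sub>R (of_int A, of_int B) + of_int (- B) *\<^sub>R ?v \<in> period G"
    by (intro period_add period_scale AB v)
  then show "(of_int c, 0) \<in> period G"
    by (simp add: c_def algebra_simps power2_eq_square)
  have "of_int ((d - e) * B) *\<^sub>R (of_int A, of_int B) + of_int A *\<^sub>R ?v \<in> period G"
    by (intro period_add period_scale AB v)
  then show "(0, of_int c) \<in> period G"
    by (simp add: c_def algebra_simps power2_eq_square)
qed

text \<open>Dilation by the absolute value of \<open>c\<close> makes every lattice vector a period,
  so all monomials become 1 and the total weight remains.\<close>

lemma lattice_area_mem:
  assumes G: "weight_elems w \<subseteq> ideal.span G"
    and c: "c \<noteq> 0" "(of_int c, 0) \<in> period G" "(0, of_int c) \<in> period G"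
  shows "of_int (lattice_area w) \<in> ideal.span G"
proof -
  have "weight_elem w (real (nat \<bar>c\<bar>)) \<in> ideal.span G"
    using c(1) by (intro subsetD[OF G]) (auto simp: weight_elems_def intro!: exI[of _ "nat \<bar>c\<bar>"])
  moreover have "weight_elem w (real (nat \<bar>c\<bar>)) - of_int (lattice_area w) \<in> ideal.span G"
  proof -
    have "weight_elem w (real (nat \<bar>c\<bar>)) - of_int (lattice_area w) =
        (\<Sum>s | w s \<noteq> 0. of_int (w s) * (mon (real (nat \<bar>c\<bar>) *\<^sub>R lattice_vec s) - 1))"
      by (simp add: weight_elem_def lattice_area_def right_diff_distrib sum_subtractf)
    also have "\<dots> \<in> ideal.span G"
    proof (intro ideal.span_sum ideal.span_scale)
      fix s
      have "of_int (sgn c * fst s) *\<^sub>R (of_int c, 0) + of_int (sgn c * snd s) *\<^sub>R (0, of_int c) \<in> period G"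
        by (intro period_add period_scale c)
      also have "of_int (sgn c * fst s) *\<^sub>R (of_int c, 0) + of_int (sgn c * snd s) *\<^sub>R (0, of_int c) =
          real (nat \<bar>c\<bar>) *\<^sub>R lattice_vec s"
        by (cases "c > 0") (simp_all add: lattice_vec_def sgn_if)
      finally show "mon (real (nat \<bar>c\<bar>) *\<^sub>R lattice_vec s) - 1 \<in> ideal.span G"
        by (simp only: period_def mem_Collect_eq)
    qed
    finally show ?thesis .
  qed
  ultimately have "weight_elem w (real (nat \<bar>c\<bar>)) -
      (weight_elem w (real (nat \<bar>c\<bar>)) - of_int (lattice_area w)) \<in> ideal.span G"
    by (rule ideal.span_diff)
  then show ?thesis by simp
qed

section \<open>The multiplicative sets used: divisors of powers of box elements, and nonzero
  integers\<close>

lemma mon_power_minus_one_dvd: "mon v - 1 dvd mon (real n *\<^sub>R v) - 1"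
  unfolding mon_scaleR_power power_diff_1_eq by simp

lemma box_elem_dvd: "box_elem (real k) dvd box_elem (real (k * n))"
  using mult_dvd_mono[OF mon_power_minus_one_dvd[of "(real k, 0)" n] mon_power_minus_one_dvd[of "(0, real k)" n]]
  by (simp add: box_elem_def mult.commute)

definition box_divisors :: "plane_ring set" where
  "box_divisors = {q. \<exists>M>0. \<exists>n. q dvd box_elem (real M) ^ n}"

lemma box_divisorsI: "M > 0 \<Longrightarrow> q dvd box_elem (real M) ^ n \<Longrightarrow> q \<in> box_divisors"
  unfolding box_divisors_def by blast

lemma mult_closed_box_divisors: "mult_closed box_divisors"
  unfolding mult_closed_def
proof (intro conjI ballI)
  show "1 \<in> box_divisors" by (auto simp: box_divisors_def)
  fix x y assume "x \<in> box_divisors" "y \<in> box_divisors"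
  then obtain K m L n where 1: "K > 0" "x dvd box_elem (real K) ^ m" "L > 0" "y dvd box_elem (real L) ^ n"
    by (auto simp: box_divisors_def)
  have "x dvd box_elem (real (K * L)) ^ m"
    using 1(2) dvd_power_same[OF box_elem_dvd[of K L]] by (rule dvd_trans)
  moreover have "y dvd box_elem (real (K * L)) ^ n"
    using 1(4) dvd_power_same[OF box_elem_dvd[of L K]] by (metis dvd_trans mult.commute)
  ultimately have "x * y dvd box_elem (real (K * L)) ^ (m + n)"
    by (simp only: power_add mult_dvd_mono)
  moreover have "K * L > 0" using 1 by simp
  ultimately show "x * y \<in> box_divisors" by (rule box_divisorsI[rotated])
qed

lemma axis_mem_box_divisors:
  assumes "c \<noteq> (0::int)" "v = (of_int c, 0) \<or> v = (0, of_int c)" "q dvd mon v - 1"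
  shows "q \<in> box_divisors"
proof -
  define n where "n = nat \<bar>c\<bar>"
  have n: "n > 0" using assms(1) by (simp add: n_def)
  have c: "real_of_int c = real n \<or> real_of_int c = - real n" by (auto simp: n_def)
  \<comment> \<open>Covers negative \<open>c\<close>: \<open>mon u - 1\<close> and
    \<open>mon (- u) - 1\<close> differ by a unit.\<close>
  have neg: "mon u - 1 dvd mon (- u) - 1" for u
  proof
    show "mon (- u) - 1 = (mon u - 1) * - mon (- u)" by (simp add: left_diff_distrib mult_single)
  qed
  have "mon v - 1 dvd box_elem (real n)"
    using assms(2) c neg[of v] by (auto simp: box_elem_def intro: dvd_mult dvd_mult2)
  then have "q dvd box_elem (real n) ^ 1" using assms(3) by (metis dvd_trans power_one_right)
  then show ?thesis by (rule box_divisorsI[OF n])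
qed

definition nonzero_ints :: "plane_ring set" where
  "nonzero_ints = of_int ` (- {0})"

lemma mult_closed_nonzero_ints: "mult_closed nonzero_ints"
  unfolding mult_closed_def nonzero_ints_def
proof (intro conjI ballI)
  show "(1 :: plane_ring) \<in> of_int ` (- {0})" by (auto intro!: image_eqI[of _ _ 1])
  fix x y :: plane_ring assume "x \<in> of_int ` (- {0})" "y \<in> of_int ` (- {0})"
  then obtain a b where "x = of_int a" "y = of_int b" "a \<noteq> 0" "b \<noteq> 0" by auto
  then show "x * y \<in> of_int ` (- {0})" by (auto intro!: image_eqI[of _ _ "a * b"])
qed

lemma lattice_vec_diff: "lattice_vec s - lattice_vec t = (of_int (fst s - fst t), of_int (snd s - snd t))"
  by (simp add: lattice_vec_def)

text \<open>Modulo one difference of cross monomials at distinct levels there is a period on each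
  axis, so \<open>axes\<close> applies. The scalar \<open>a\<close> is treated as one more factor of
  the product.\<close>

lemma meets_cross_mon_diffs:
  assumes W: "mult_closed W" and C: "finite C"
    and AB: "(of_int A, of_int B) \<in> period G" "(A, B) \<noteq> (0, 0)"
    and mem: "of_int a * root_diffs (cross_mon A B) C \<in> ideal.span G"
    and a: "meets W (insert (of_int a) G)"
    and axes: "\<And>H c. \<lbrakk>G \<subseteq> H; c \<noteq> (0::int); (of_int c, 0) \<in> period H; (0, of_int c) \<in> period H\<rbrakk> \<Longrightarrow> meets W H"
  shows "meets W G"
proof -
  have "meets W (insert (root_diffs (cross_mon A B) C) G)"
    unfolding root_diffs_def
  proof (rule meets_insert_prod[OF W])
    fix p assume p: "p \<in> C \<times> C - Id"
    define H where "H = insert (cross_mon A B (fst p) - cross_mon A B (snd p)) G"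
    have H: "G \<subseteq> H" by (auto simp: H_def)
    have "cross_mon A B (fst p) - cross_mon A B (snd p) \<in> ideal.span H"
      by (simp add: H_def ideal.span_base)
    moreover have "fst p \<noteq> snd p" using p by auto
    ultimately obtain c where "c \<noteq> 0" "(of_int c, 0) \<in> period H" "(0, of_int c) \<in> period H"
      using cross_mon_diff_period[OF subsetD[OF period_mono[OF H] AB(1)] AB(2)] by blast
    then have "meets W H" by (rule axes[OF H])
    then show "meets W (insert (case p of (c, d) \<Rightarrow> cross_mon A B c - cross_mon A B d) G)"
      by (simp add: H_def case_prod_beta)
  qed (use C in auto)
  then have "meets W (insert (of_int a * root_diffs (cross_mon A B) C) G)"
    by (rule meets_insert_mult[OF W a])
  then show ?thesis using mem by (rule meets_redundant)
qed

section \<open>The ideal generated by the weight elements\<close>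

context
  fixes w :: "int \<times> int \<Rightarrow> int"
  assumes fin: "finite {s. w s \<noteq> 0}"
    and Gcd: "\<And>\<mu>. \<mu> \<in> \<rat> - {0} \<Longrightarrow> Gcd (lattice_area ` slope_classes \<mu> w) = 1"
begin

text \<open>Class areas are sums of weights, so a common divisor of the weights divides all class
  areas of slope 1.\<close>

lemma Gcd_weights: "Gcd (w ` {s. w s \<noteq> 0}) = 1"
proof -
  have "Gcd (w ` {s. w s \<noteq> 0}) dvd Gcd (lattice_area ` slope_classes 1 w)"
    unfolding lattice_area_slope_classes
  proof (intro Gcd_greatest, clarify)
    show "Gcd (w ` {s. w s \<noteq> 0}) dvd (\<Sum>s | w s \<noteq> 0 \<and> slope_level 1 s = e. w s)" for e
      by (intro dvd_sum Gcd_dvd) auto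
  qed
  then show ?thesis using Gcd[of 1] by simp
qed

text \<open>Interpolation puts the product of all monomial differences into the ideal; modulo one of
  them there is a nonzero lattice period.\<close>

lemma meets_if_meets_differences:
  assumes W: "mult_closed W"
    and diffs: "\<And>A B G. \<lbrakk>weight_elems w \<subseteq> ideal.span G; (of_int A, of_int B) \<in> period G; (A, B) \<noteq> (0, 0)\<rbrakk>
      \<Longrightarrow> meets W G"
  shows "meets W (weight_elems w)"
proof (rule meets_prod[OF W])
  let ?S = "{s. w s \<noteq> 0}" and ?m = "\<lambda>s. mon (lattice_vec s)"
  show "finite (?S \<times> ?S - Id)" using fin by auto
  show "(\<Prod>(s, t)\<in>?S \<times> ?S - Id. ?m s - ?m t) \<in> ideal.span (weight_elems w)"
    unfolding root_diffs_def[symmetric]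
  proof (rule root_diffs_mem[OF fin])
    fix t :: nat assume "t \<ge> 1"
    then have "weight_elem w (real t) \<in> ideal.span (weight_elems w)"
      by (intro ideal.span_base) (auto simp: weight_elems_def)
    then show "(\<Sum>s\<in>?S. of_int (w s) * ?m s ^ t) \<in> ideal.span (weight_elems w)"
      by (simp add: weight_elem_def mon_scaleR_power)
  qed (use Gcd_weights mon_dvd_one in auto)
  fix p assume p: "p \<in> ?S \<times> ?S - Id"
  obtain s t where st: "p = (s, t)" "s \<noteq> t" using p by (cases p) auto
  let ?G = "insert (?m s - ?m t) (weight_elems w)"
  have "meets W ?G"
  proof (rule diffs)
    show "weight_elems w \<subseteq> ideal.span ?G" by (auto intro: ideal.span_base)
    have "lattice_vec s - lattice_vec t \<in> period ?G"
      by (simp add: period_diff_iff ideal.span_base)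
    then show "(of_int (fst s - fst t), of_int (snd s - snd t)) \<in> period ?G"
      by (simp only: lattice_vec_diff)
    show "(fst s - fst t, snd s - snd t) \<noteq> (0, 0)"
      using st(2) by (auto simp: prod_eq_iff)
  qed
  then show "meets W (insert (case p of (s, t) \<Rightarrow> ?m s - ?m t) (weight_elems w))"
    by (simp add: st)
qed

lemma meets_box_divisors: "meets box_divisors (weight_elems w)"
proof (rule meets_if_meets_differences[OF mult_closed_box_divisors])
  have axis: "meets box_divisors G"
    if "v \<in> period G" "c \<noteq> 0" "v = (of_int c, 0) \<or> v = (0, of_int c)" for G v and c :: int
    using axis_mem_box_divisors[OF that(2,3) dvd_refl] that(1)
    by (intro meetsI[of "mon v - 1"]) (simp_all add: period_def)
  fix A B G
  assume G: "weight_elems w \<subseteq> ideal.span G"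
    and AB: "(of_int A, of_int B) \<in> period G" "(A, B) \<noteq> (0, 0)"
  let ?S = "{s. w s \<noteq> 0}"
  show "meets box_divisors G"
  \<comment> \<open>A period along an axis has no nonzero rational slope; there
    \<open>mon v - 1\<close> itself divides a box element.\<close>
  proof (cases "A = 0 \<or> B = 0")
    case True
    then show ?thesis using axis[OF AB(1), of A] axis[OF AB(1), of B] AB(2) by auto
  next
    case False
    have "real_of_int B / of_int A \<in> \<rat> - {0}" using False by simp
    then have "root_diffs (cross_mon A B) (cross_level A B ` ?S) \<in> ideal.span G"
      using fin False Gcd
      by (intro root_diffs_mem[where a = "cross_weight A B w"] cross_power_sum[OF fin G AB]
          cross_mon_dvd_one) (simp_all add: cross_weight_image)
    then have "of_int 1 * root_diffs (cross_mon A B) (cross_level A B ` ?S) \<in> ideal.span G" by simp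
    moreover have "meets box_divisors (insert (of_int 1) G)"
      using mult_closed_box_divisors
      by (intro meetsI[of 1]) (auto simp: mult_closed_def ideal.span_base)
    ultimately show ?thesis
      by (rule meets_cross_mon_diffs[OF mult_closed_box_divisors finite_imageI[OF fin] AB]) (blast intro: axis)
  qed
qed

lemma meets_nonzero_ints:
  assumes area: "lattice_area w \<noteq> 0"
  shows "meets nonzero_ints (weight_elems w)"
proof (rule meets_if_meets_differences[OF mult_closed_nonzero_ints])
  fix A B G
  assume G: "weight_elems w \<subseteq> ideal.span G"
    and AB: "(of_int A, of_int B) \<in> period G" "(A, B) \<noteq> (0, 0)"
  let ?S = "{s. w s \<noteq> 0}"
  \<comment> \<open>The cross weights add up to the nonzero area, so one of them is nonzero and can
    be isolated.\<close>
  have "(\<Sum>e\<in>cross_level A B ` ?S. cross_weight A B w e) = lattice_area w"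
    using sum.image_gen[OF fin, of w "cross_level A B"]
    by (simp add: cross_weight_def lattice_area_def)
  then obtain e where e: "e \<in> cross_level A B ` ?S" "cross_weight A B w e \<noteq> 0"
    using area by (metis sum.neutral)
  show "meets nonzero_ints G"
  proof (rule meets_cross_mon_diffs[OF mult_closed_nonzero_ints _ AB])
    show "finite (cross_level A B ` ?S)" using fin by simp
    show "of_int (cross_weight A B w e) * root_diffs (cross_mon A B) (cross_level A B ` ?S) \<in> ideal.span G"
      using fin e
      by (intro lagrange_isolate[where a = "\<lambda>e. of_int (cross_weight A B w e)"]
          cross_power_sum[OF fin G AB] cross_mon_dvd_one) auto
    show "meets nonzero_ints (insert (of_int (cross_weight A B w e)) G)"
      using e by (intro meetsI[of "of_int (cross_weight A B w e)"])
        (auto simp: nonzero_ints_def ideal.span_base)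
    fix H c assume H: "G \<subseteq> H" and c: "c \<noteq> (0::int)" "(of_int c, 0) \<in> period H" "(0, of_int c) \<in> period H"
    have "weight_elems w \<subseteq> ideal.span H" using G ideal.span_mono[OF H] by blast
    then have "of_int (lattice_area w) \<in> ideal.span H" using c by (rule lattice_area_mem)
    then show "meets nonzero_ints H"
      using area by (intro meetsI) (auto simp: nonzero_ints_def)
  qed
qed

end

section \<open>From the weight elements to tiles\<close>

definition tile_elems :: "(int \<times> int \<Rightarrow> int) \<Rightarrow> plane_ring set" where
  "tile_elems w = {weight_elem w (real k) * box_elem (real k) |k::nat. k \<ge> 1}"

text \<open>\<open>K\<close> is the product of the dilation factors \<open>k\<close> in a
  combination giving \<open>x\<close>, so each \<open>box_elem k\<close> divides
  \<open>box_elem (K * n)\<close>. Freedom in \<open>n\<close> lets the constants of several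
  \<open>x\<close> be merged.\<close>

lemma box_elem_mult_mem:
  assumes "x \<in> ideal.span (weight_elems w)"
  shows "\<exists>K>0. \<forall>n. box_elem (real (K * n)) * x \<in> ideal.span (tile_elems w)"
  using assms
proof (induction rule: ideal.span_induct_alt)
  case base
  then show ?case by (auto simp: ideal.span_zero)
next
  case (step c g y)
  obtain k where k: "k \<ge> 1" "g = weight_elem w (real k)"
    using step(1) by (auto simp: weight_elems_def)
  obtain K where K: "K > 0" "\<And>n. box_elem (real (K * n)) * y \<in> ideal.span (tile_elems w)"
    using step(2) by blast
  have "box_elem (real (k * K * n)) * (c * g + y) \<in> ideal.span (tile_elems w)" for n
  proof -
    have "weight_elem w (real k) * box_elem (real k) \<in> ideal.span (tile_elems w)"
      using k by (intro ideal.span_base) (auto simp: tile_elems_def)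
    moreover have "weight_elem w (real k) * box_elem (real k) dvd box_elem (real (k * (K * n))) * (c * g)"
      using mult_dvd_mono[OF dvd_triv_right box_elem_dvd[of k "K * n"], of "weight_elem w (real k)" c]
      by (simp add: k mult_ac)
    ultimately have "box_elem (real (k * (K * n))) * (c * g) \<in> ideal.span (tile_elems w)"
      by (rule ideal_dvd)
    from ideal.span_add[OF this K(2)[of "k * n"]] show ?thesis
      by (simp add: distrib_left distrib_right mult_ac)
  qed
  then show ?case using k K(1) by (intro exI[of _ "k * K"]) auto
qed

text \<open>After \<open>power_tower_minus_one\<close> is applied to both variables, every term of
  the product contains \<open>box_elem K * m\<close> or \<open>box_elem K ^ (n + 1)\<close>, and
  both lie in the tile ideal.\<close>

lemma box_elem_mem_tile_elems:
  assumes ints: "meets nonzero_ints (weight_elems w)" and boxes: "meets box_divisors (weight_elems w)"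
  obtains r :: nat where "r > 0" "box_elem (real r) \<in> ideal.span (tile_elems w)"
proof -
  obtain b where b: "b \<noteq> 0" "of_int b \<in> ideal.span (weight_elems w)"
    using ints by (auto simp: meets_def nonzero_ints_def)
  obtain q M n where M: "M > 0" and q: "q dvd box_elem (real M) ^ n" "q \<in> ideal.span (weight_elems w)"
    using boxes by (auto simp: meets_def box_divisors_def)
  have "box_elem (real M) ^ n \<in> ideal.span (weight_elems w)" using q by (blast intro: ideal_dvd)
  then obtain K1 where K1: "K1 > 0"
    "\<And>k. box_elem (real (K1 * k)) * box_elem (real M) ^ n \<in> ideal.span (tile_elems w)"
    using box_elem_mult_mem by blast
  obtain K2 where K2: "K2 > 0" "\<And>k. box_elem (real (K2 * k)) * of_int b \<in> ideal.span (tile_elems w)"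
    using box_elem_mult_mem[OF b(2)] by blast
  \<comment> \<open>\<open>K1\<close> and \<open>K2\<close> bring the two products into the tile
    ideal; the factor \<open>M\<close> makes \<open>box_elem M\<close> divide
    \<open>box_elem K\<close>.\<close>
  define K where "K = K1 * K2 * M"
  define m where "m = nat \<bar>b\<bar>"
  let ?x = "mon (real K, 0)" and ?y = "mon (0, real K)"
  have box: "box_elem (real K) = (?x - 1) * (?y - 1)" by (simp add: box_elem_def)
  have "box_elem (real K) * box_elem (real M) ^ n \<in> ideal.span (tile_elems w)"
    using K1(2)[of "K2 * M"] by (simp only: K_def mult.assoc)
  moreover have "box_elem (real M) ^ n dvd box_elem (real K) ^ n"
    using box_elem_dvd[of M "K1 * K2"] by (intro dvd_power_same) (simp add: K_def mult_ac)
  ultimately have 1: "box_elem (real K) * box_elem (real K) ^ n \<in> ideal.span (tile_elems w)"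
    by (meson ideal_dvd mult_dvd_mono dvd_refl)
  have "box_elem (real K) * of_int b \<in> ideal.span (tile_elems w)"
    using K2(2)[of "K1 * M"] by (simp only: K_def mult_ac)
  moreover have "(of_int b :: plane_ring) dvd of_nat m"
    by (cases "b \<ge> 0") (simp_all add: m_def of_nat_nat)
  ultimately have 2: "box_elem (real K) * of_nat m \<in> ideal.span (tile_elems w)"
    by (meson ideal_dvd mult_dvd_mono dvd_refl)
  obtain f g where x: "?x ^ (m ^ n) - 1 = (?x - 1) * (of_nat m * f + (?x - 1) ^ n * g)"
    using power_tower_minus_one[of ?x m n] by blast
  obtain f' g' where y: "?y ^ (m ^ n) - 1 = (?y - 1) * (of_nat m * f' + (?y - 1) ^ n * g')"
    using power_tower_minus_one[of ?y m n] by blast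
  have "box_elem (real (m ^ n * K)) = (?x ^ (m ^ n) - 1) * (?y ^ (m ^ n) - 1)"
    by (simp add: box_elem_def mon_scaleR_power[symmetric])
  also have "\<dots> = box_elem (real K) * of_nat m *
        (f * (of_nat m * f' + (?y - 1) ^ n * g') + (?x - 1) ^ n * g * f') +
      box_elem (real K) * box_elem (real K) ^ n * (g * g')"
    unfolding x y box power_mult_distrib by (simp only: distrib_left distrib_right mult_ac add_ac)
  also have "\<dots> \<in> ideal.span (tile_elems w)"
    by (intro ideal.span_add ideal_mult_right 1 2)
  finally have "box_elem (real (m ^ n * K)) \<in> ideal.span (tile_elems w)" .
  moreover have "m ^ n * K > 0" using K1 K2 M b by (simp add: K_def m_def)
  ultimately show ?thesis by (rule that[rotated])
qed

lemma shapetiles_squareI: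
  assumes "r > 0" "box_elem (real r) \<in> ideal.span (tile_elems w)"
  shows "Z_shapetiles (lattice_tile w) (indicator ({0..<real r} \<times> {0..<real r}))"
proof -
  have "Z_tiles {dilate \<rho> (lattice_tile w) |\<rho>. \<rho> > 0} (act (box_elem (real r)) quadrant)"
  proof (rule Z_tiles_act[OF assms(2)])
    fix g assume "g \<in> tile_elems w"
    then obtain k :: nat where k: "k \<ge> 1" "g = weight_elem w (real k) * box_elem (real k)"
      by (auto simp: tile_elems_def)
    then have "act g quadrant = dilate (real k) (lattice_tile w)"
      by (simp add: dilate_lattice_tile)
    moreover have "real k > 0" using k by simp
    ultimately show "act g quadrant \<in> {dilate \<rho> (lattice_tile w) |\<rho>. \<rho> > 0}" by blast
  qed
  moreover have "act (box_elem (real r)) quadrant = indicator ({0..<real r} \<times> {0..<real r})"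
    using act_box_elem[of "real r" 0 0] assms(1) by (simp add: zero_prod_def[symmetric])
  ultimately show ?thesis unfolding Z_shapetiles_def by simp
qed

theorem theorem4p2:
  fixes w :: "int \<times> int \<Rightarrow> int"
  assumes "finite {s. w s \<noteq> 0}"
  shows "(\<exists>Q. is_square Q \<and> Z_shapetiles (lattice_tile w) (indicator Q)) \<longleftrightarrow>
    weighted_area (lattice_tile w) \<noteq> 0 \<and>
    (\<forall>\<mu>\<in>\<rat> - {0}. Gcd (lattice_area ` slope_classes \<mu> w) = 1)"
proof (intro iffI conjI ballI)
  assume "\<exists>Q. is_square Q \<and> Z_shapetiles (lattice_tile w) (indicator Q)"
  then obtain Q where Q: "is_square Q" "Z_shapetiles (lattice_tile w) (indicator Q)" by blast
  show "weighted_area (lattice_tile w) \<noteq> 0"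
    using shapetiles_square_imp_area[OF Q] weighted_area_lattice_tile[OF assms] by simp
  show "Gcd (lattice_area ` slope_classes \<mu> w) = 1" if "\<mu> \<in> \<rat> - {0}" for \<mu>
    using shapetiles_square_imp_Gcd[OF assms Q] that by simp
next
  assume *: "weighted_area (lattice_tile w) \<noteq> 0 \<and>
    (\<forall>\<mu>\<in>\<rat> - {0}. Gcd (lattice_area ` slope_classes \<mu> w) = 1)"
  then have "lattice_area w \<noteq> 0" using weighted_area_lattice_tile[OF assms] by simp
  then obtain r :: nat where r: "r > 0" "box_elem (real r) \<in> ideal.span (tile_elems w)"
    using box_elem_mem_tile_elems meets_nonzero_ints meets_box_divisors assms * by metis
  have "is_square ({0..<real r} \<times> {0..<real r})"
    using r(1) unfolding is_square_def by (intro exI[of _ 0] exI[of _ "real r"]) simp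
  then show "\<exists>Q. is_square Q \<and> Z_shapetiles (lattice_tile w) (indicator Q)"
    using shapetiles_squareI[OF r] by blast
qed

end
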